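(* Let $\mathcal{H}=(C,F,D,G)$ be a hybrid system on $\mathbb{R}^n$ such that $F$ is outer semicontinuous and locally bounded with nonempty and convex images, and $G(x)\neq\emptyset$ for all $x\in D$. Let $B:\mathbb{R}^n\to\mathbb{R}^m$ be a barrier function candidate defining the set $K=\{x\in C\cup D:B(x)\le0\}$, and assume $K$ is closed. Suppose that $B(\eta)\le0$ for all $\eta\in G(x)$ and all $x\in D\cap K$, that $G(x)\subset C\cup D$ for all $x\in D\cap K$, and that there exists an open neighborhood $U(\partial K)$ of $\partial K$ such that $$\eta\in E_K(x)\quad\forall\eta\in F(x)\cap T_C(x),\ \forall x\in(U(\partial K)\setminus K)\cap C.$$ Then $K$ is forward pre-invariant for $\mathcal{H}$.
   Context: A hybrid system $\mathcal{H}=(C,F,D,G)$ consists of sets $C,D\subset\mathbb{R}^n$ and set-valued maps $F,G:\mathbb{R}^n\rightrightarrows\mathbb{R}^n$, and represents $\dot x\in F(x)$ for $x\in C$ and $x^+\in G(x)$ for $x\in D$. A hybrid time domain is a set $E\subset\mathbb{R}_{\ge0}\times\mathbb{N}$ such that for each $(T,J)\in E$, $E\cap([0,T]\times\{0,\dots,J\})=\bigcup_{j=0}^J([t_j,t_{j+1}]\times\{j\})$ for some $0=t_0\le t_1\le\dots\le t_{J+1}$. A solution $x$ to $\mathcal{H}$ is a function $x:\operatorname{dom}x\to\mathbb{R}^n$ on a hybrid time domain $\operatorname{dom}x$, with $t\mapsto x(t,j)$ locally absolutely continuous on $I^j:=\{t:(t,j)\in\operatorname{dom}x\}$ for each $j$,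 such that: $x(0,0)\in\mathrm{cl}(C)\cup D$; for every $j$ for which $I^j$ has nonempty interior, $x(t,j)\in C$ for all $t\in\mathrm{int}(I^j)$ and $\dot x(t,j)\in F(x(t,j))$ for almost all $t\in I^j$; and for all $(t,j)\in\operatorname{dom}x$ with $(t,j+1)\in\operatorname{dom}x$, $x(t,j)\in D$ and $x(t,j+1)\in G(x(t,j))$. It starts from $x_o$ if $x(0,0)=x_o$. It is maximal if there is no solution $y$ with $\operatorname{dom}x$ a proper subset of $\operatorname{dom}y$ and $y=x$ on $\operatorname{dom}x$. A set $K\subset C\cup D$ is forward pre-invariant for $\mathcal{H}$ if for each $x_o\in K$ and each maximal solution $x$ starting from $x_o$, $x(t,j)\in K$ for all $(t,j)\in\operatorname{dom}x$. $B:\mathbb{R}^n\to\mathbb{R}^m$ is a barrier function candidate defining $K$ if $K=\{x\in C\cup D:B(x)\le0\}$; vector inequalities are componentwise. With $|z|_S=\inf_{y\in S}|z-y|$: the contingent cone of $S$ at $x$ is $T_S(x)=\{v:\liminf_{h\to0^+}|x+hv|_S/h=0\}$, and the external contingent cone of $S$ at $x$ is $E_S(x)=\{v:\liminf_{h\to0^+}(|x+hv|_S-|x|_S)/h\le0\}$. $\partial S$ denotes the boundary of $S$. *)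

theory Defs
  imports "HOL-Analysis.Analysis"
begin

section \<open>Hybrid systems and their solutions\<close>

record 'a hybrid_system =
  flow_set :: "'a set"
  flow_map :: "'a \<Rightarrow> 'a set"
  jump_set :: "'a set"
  jump_map :: "'a \<Rightarrow> 'a set"

definition hybrid_time_domain :: "(real \<times> nat) set \<Rightarrow> bool" where
  "hybrid_time_domain E \<longleftrightarrow>
     E \<subseteq> {0..} \<times> UNIV \<and>
     (\<forall>(T, J) \<in> E. \<exists>t :: nat \<Rightarrow> real.
        t 0 = 0 \<and> (\<forall>j\<le>J. t j \<le> t (Suc j)) \<and>
        E \<inter> ({0..T} \<times> {..J}) = (\<Union>j\<le>J. {t j..t (Suc j)} \<times> {j}))"

definition time_slice :: "(real \<times> nat) set \<Rightarrow> nat \<Rightarrow> real set" where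
  "time_slice E j = {t. (t, j) \<in> E}"

text \<open>The usual \<open>\<epsilon>\<close>-\<open>\<delta>\<close> notion of absolute continuity of a function on a compact
  interval. It is unrelated to \<^const>\<open>absolutely_continuous\<close>, which concerns measures.\<close>

definition abs_cont_on_interval :: "real \<Rightarrow> real \<Rightarrow> (real \<Rightarrow> 'a::real_normed_vector) \<Rightarrow> bool" where
  "abs_cont_on_interval a b f \<longleftrightarrow>
     (\<forall>\<epsilon>>0. \<exists>\<delta>>0. \<forall>(N::nat) u v.
        (\<forall>k<N. a \<le> u k \<and> u k \<le> v k \<and> v k \<le> b) \<longrightarrow>
        disjoint_family_on (\<lambda>k. {u k<..<v k}) {..<N} \<longrightarrow>
        (\<Sum>k<N. v k - u k) < \<delta> \<longrightarrow>
        (\<Sum>k<N. norm (f (v k) - f (u k))) < \<epsilon>)"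

definition locally_abs_cont_on :: "real set \<Rightarrow> (real \<Rightarrow> 'a::real_normed_vector) \<Rightarrow> bool" where
  "locally_abs_cont_on I f \<longleftrightarrow> (\<forall>a b. a \<le> b \<longrightarrow> {a..b} \<subseteq> I \<longrightarrow> abs_cont_on_interval a b f)"

text \<open>A hybrid arc is given by its domain \<open>E\<close> together with a function \<open>x\<close> whose values
  outside \<open>E\<close> are irrelevant.\<close>

definition hybrid_solution ::
    "'a::euclidean_space hybrid_system \<Rightarrow> (real \<times> nat) set \<Rightarrow> (real \<Rightarrow> nat \<Rightarrow> 'a) \<Rightarrow> bool" where
  "hybrid_solution H E x \<longleftrightarrow>
     hybrid_time_domain E \<and>
     (\<forall>j. locally_abs_cont_on (time_slice E j) (\<lambda>t. x t j)) \<and>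
     (0, 0) \<in> E \<and> x 0 0 \<in> closure (flow_set H) \<union> jump_set H \<and>
     (\<forall>j. interior (time_slice E j) \<noteq> {} \<longrightarrow>
        (\<forall>t \<in> interior (time_slice E j). x t j \<in> flow_set H) \<and>
        (AE t in lebesgue. t \<in> time_slice E j \<longrightarrow>
           (\<exists>v \<in> flow_map H (x t j).
              ((\<lambda>s. x s j) has_vector_derivative v) (at t within time_slice E j)))) \<and>
     (\<forall>t j. (t, j) \<in> E \<longrightarrow> (t, Suc j) \<in> E \<longrightarrow>
        x t j \<in> jump_set H \<and> x t (Suc j) \<in> jump_map H (x t j))"

definition maximal_hybrid_solution ::
    "'a::euclidean_space hybrid_system \<Rightarrow> (real \<times> nat) set \<Rightarrow> (real \<Rightarrow> nat \<Rightarrow> 'a) \<Rightarrow> bool" where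
  "maximal_hybrid_solution H E x \<longleftrightarrow>
     hybrid_solution H E x \<and>
     \<not> (\<exists>E' y. hybrid_solution H E' y \<and> E \<subset> E' \<and> (\<forall>(t, j) \<in> E. y t j = x t j))"

definition forward_pre_invariant :: "'a::euclidean_space hybrid_system \<Rightarrow> 'a set \<Rightarrow> bool" where
  "forward_pre_invariant H K \<longleftrightarrow>
     K \<subseteq> flow_set H \<union> jump_set H \<and>
     (\<forall>x\<^sub>o \<in> K. \<forall>E x. maximal_hybrid_solution H E x \<and> x 0 0 = x\<^sub>o \<longrightarrow>
        (\<forall>(t, j) \<in> E. x t j \<in> K))"

section \<open>Barrier function candidates\<close>

text \<open>The order on vectors is the componentwise one.\<close>

definition barrier_candidate ::
    "(real^'n) hybrid_system \<Rightarrow> (real^'n \<Rightarrow> real^'m) \<Rightarrow> (real^'n) set \<Rightarrow> bool" where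
  "barrier_candidate H B K \<longleftrightarrow> K = {x \<in> flow_set H \<union> jump_set H. B x \<le> 0}"

section \<open>Set-valued maps and tangent cones\<close>

definition outer_semicontinuous ::
    "('a::topological_space \<Rightarrow> 'b::topological_space set) \<Rightarrow> bool" where
  "outer_semicontinuous F \<longleftrightarrow>
     (\<forall>x y (X :: nat \<Rightarrow> 'a) Y.
        X \<longlonglongrightarrow> x \<longrightarrow> (\<forall>i. Y i \<in> F (X i)) \<longrightarrow> Y \<longlonglongrightarrow> y \<longrightarrow> y \<in> F x)"

definition locally_bounded_map ::
    "('a::topological_space \<Rightarrow> 'b::metric_space set) \<Rightarrow> bool" where
  "locally_bounded_map F \<longleftrightarrow> (\<forall>x. \<exists>U. open U \<and> x \<in> U \<and> bounded (\<Union>z\<in>U. F z))"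

text \<open>The cones are meant for nonempty \<open>S\<close>: \<^term>\<open>infdist z {}\<close> is \<open>0\<close>, not infinity.\<close>

definition contingent_cone :: "'a::euclidean_space set \<Rightarrow> 'a \<Rightarrow> 'a set" where
  "contingent_cone S x =
     {v. Liminf (at_right 0) (\<lambda>h. ereal (infdist (x + h *\<^sub>R v) S / h)) = 0}"

definition external_contingent_cone :: "'a::euclidean_space set \<Rightarrow> 'a \<Rightarrow> 'a set" where
  "external_contingent_cone S x =
     {v. Liminf (at_right 0) (\<lambda>h. ereal ((infdist (x + h *\<^sub>R v) S - infdist x S) / h)) \<le> 0}"

end

theory Submission
  imports Defs
begin

text \<open>Only flowing can make a solution leave \<open>K\<close>. If it does, there is an interval \<open>[c, e]\<close> on
  which the arc starts in \<open>\<partial>K\<close> and then stays in \<open>U - K\<close>. There the velocity lies almost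
  everywhere in the contingent cone of the flow set, because the arc itself stays in the flow set,
  hence in the external contingent cone of \<open>K\<close>. As the distance to \<open>K\<close> is 1-Lipschitz, the
  lower right Dini derivative of \<open>t \<mapsto> |x(t)|\<^sub>K\<close> is therefore nonpositive almost everywhere; this
  function is absolutely continuous, so it does not increase and stays \<open>0\<close>, a contradiction.\<close>

section \<open>Absolute continuity and Lipschitz bounds\<close>

lemma abs_cont_on_interval_imp_continuous_on:
  fixes f :: "real \<Rightarrow> 'a::real_normed_vector"
  assumes "abs_cont_on_interval a b f"
  shows "continuous_on {a..b} f"
proof -
  have "\<exists>d>0. \<forall>s\<in>{a..b}. dist s t < d \<longrightarrow> dist (f s) (f t) < e"
    if "t \<in> {a..b}" "e > 0" for t e
  proof -
    obtain d where d: "d > 0"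
      and ac: "\<And>N u v. \<lbrakk>\<And>k. k < N \<Longrightarrow> a \<le> u k \<and> u k \<le> v k \<and> v k \<le> b;
          disjoint_family_on (\<lambda>k. {u k<..<v k}) {..<N}; (\<Sum>k<N. v k - u k) < d\<rbrakk>
        \<Longrightarrow> (\<Sum>k<(N::nat). norm (f (v k) - f (u k))) < e"
      using assms \<open>e > 0\<close> unfolding abs_cont_on_interval_def by meson
    have "dist (f s) (f t) < e" if "s \<in> {a..b}" "dist s t < d" for s
    proof -
      \<comment> \<open>A family of one interval suffices; \<open>min\<close> and \<open>max\<close>
        order its endpoints without a case split.\<close>
      have "(\<Sum>k<(1::nat). norm (f (max s t) - f (min s t))) < e"
        using that \<open>t \<in> {a..b}\<close>
        by (intro ac[of 1 "\<lambda>_. min s t" "\<lambda>_. max s t"])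
          (auto simp: disjoint_family_on_def dist_real_def)
      then show ?thesis
        by (auto simp: dist_norm max_def min_def norm_minus_commute split: if_splits)
    qed
    with d show ?thesis by blast
  qed
  then show ?thesis unfolding continuous_on_iff by blast
qed

lemma abs_cont_on_interval_subinterval:
  assumes "abs_cont_on_interval a b f" "a \<le> c" "d \<le> b"
  shows "abs_cont_on_interval c d f"
  unfolding abs_cont_on_interval_def
proof (intro allI impI)
  fix e :: real assume "e > 0"
  then obtain \<delta> where "\<delta> > 0"
    and ac: "\<And>N u v. \<lbrakk>\<forall>k<(N::nat). a \<le> u k \<and> u k \<le> v k \<and> v k \<le> b;
          disjoint_family_on (\<lambda>k. {u k<..<v k}) {..<N}; (\<Sum>k<N. v k - u k) < \<delta>\<rbrakk>
        \<Longrightarrow> (\<Sum>k<N. norm (f (v k) - f (u k))) < e"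
    using assms(1) unfolding abs_cont_on_interval_def by meson
  show "\<exists>\<delta>>0. \<forall>N u v. (\<forall>k<(N::nat). c \<le> u k \<and> u k \<le> v k \<and> v k \<le> d) \<longrightarrow>
      disjoint_family_on (\<lambda>k. {u k<..<v k}) {..<N} \<longrightarrow> (\<Sum>k<N. v k - u k) < \<delta> \<longrightarrow>
      (\<Sum>k<N. norm (f (v k) - f (u k))) < e"
    using assms(2,3) \<open>\<delta> > 0\<close> by (intro exI[of _ \<delta>] conjI allI impI ac) force+
qed

text \<open>Serves to pass absolute continuity from an arc to its distance to \<open>K\<close>: the
  premise \<open>le\<close> is what composition with a 1-Lipschitz map provides.\<close>

lemma abs_cont_on_interval_mono:
  assumes "abs_cont_on_interval a b f"
    and le: "\<And>s t. norm (g t - g s) \<le> norm (f t - f s)"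
  shows "abs_cont_on_interval a b g"
  unfolding abs_cont_on_interval_def
proof (intro allI impI)
  fix e :: real assume "e > 0"
  then obtain \<delta> where "\<delta> > 0"
    and ac: "\<And>N u v. \<lbrakk>\<forall>k<(N::nat). a \<le> u k \<and> u k \<le> v k \<and> v k \<le> b;
          disjoint_family_on (\<lambda>k. {u k<..<v k}) {..<N}; (\<Sum>k<N. v k - u k) < \<delta>\<rbrakk>
        \<Longrightarrow> (\<Sum>k<N. norm (f (v k) - f (u k))) < e"
    using assms(1) unfolding abs_cont_on_interval_def by meson
  have "(\<Sum>k<N. norm (g (v k) - g (u k))) \<le> (\<Sum>k<N. norm (f (v k) - f (u k)))"
    for N :: nat and u v by (intro sum_mono le)
  with \<open>\<delta> > 0\<close> show "\<exists>\<delta>>0. \<forall>N u v. (\<forall>k<(N::nat). a \<le> u k \<and> u k \<le> v k \<and> v k \<le> b) \<longrightarrow>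
      disjoint_family_on (\<lambda>k. {u k<..<v k}) {..<N} \<longrightarrow> (\<Sum>k<N. v k - u k) < \<delta> \<longrightarrow>
      (\<Sum>k<N. norm (g (v k) - g (u k))) < e"
    by (intro exI[of _ \<delta>] conjI allI impI) (assumption, rule le_less_trans, assumption, rule ac)
qed

lemma infdist_diff_le_norm: "\<bar>infdist x S - infdist y S\<bar> \<le> norm (x - y)"
  using infdist_triangle[of x S y] infdist_triangle[of y S x] by (auto simp: dist_norm norm_minus_commute)

section \<open>Monotonicity from a Dini derivative\<close>

text \<open>Disjointness of the open intervals is enough, since endpoints carry no measure. This
  turns a small measure of \<open>W\<close> into the small total length that absolute continuity
  asks for.\<close>

lemma sum_lengths_le_measure:
  fixes W :: "real set"
  assumes W: "W \<in> lmeasurable"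
    and le: "\<And>k. k < (N::nat) \<Longrightarrow> u k \<le> v k \<and> {u k..v k} \<subseteq> W"
    and disj: "disjoint_family_on (\<lambda>k. {u k<..<v k}) {..<N}"
  shows "(\<Sum>k<N. v k - u k) \<le> measure lebesgue W"
proof -
  have "(\<Sum>k<N. v k - u k) = (\<Sum>k<N. measure lebesgue {u k<..<v k})"
    using le by (intro sum.cong) auto
  also have "\<dots> = measure lebesgue (\<Union>k<N. {u k<..<v k})"
    by (rule measure_finite_Union[symmetric]) (use disj le in \<open>auto simp: less_imp_le\<close>)
  also have "\<dots> \<le> measure lebesgue W"
    using le W by (intro measure_mono_fmeasurable) (fastforce intro: sets.finite_UN)+
  finally show ?thesis .
qed

text \<open>Instead of a Vitali covering, a continuation argument: cover the null set by an open set \<open>W\<close>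
  of small measure and let \<open>V t\<close> be the variation of \<open>f\<close> over \<open>W \<inter> [a, t]\<close>, which absolute
  continuity keeps below \<open>e\<close>. The bound \<open>f t - f a \<le> e (t - a) + V t\<close> can be continued to
  the right past every point: inside \<open>W\<close> thanks to \<open>V\<close>, elsewhere by the Dini derivative.\<close>

lemma abs_cont_Dini_nonincreasing:
  fixes f :: "real \<Rightarrow> real"
  assumes "a \<le> b" and ac: "abs_cont_on_interval a b f" and Z: "negligible Z"
    and dini: "\<And>t e. \<lbrakk>a \<le> t; t < b; t \<notin> Z; e > 0\<rbrakk>
      \<Longrightarrow> \<exists>\<^sub>F h in at_right 0. f (t + h) - f t \<le> e * h"
  shows "f b \<le> f a"
proof -
  \<comment> \<open>The term \<open>e * (b - a)\<close> pays for the slopes off \<open>Z\<close>,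
    the last \<open>e\<close> for the variation over \<open>W\<close>.\<close>
  have main: "f b - f a \<le> e * (b - a) + e" if "e > 0" for e
  proof -
    obtain \<delta> where "\<delta> > 0"
      and \<delta>: "\<And>N u v. \<lbrakk>\<forall>k<(N::nat). a \<le> u k \<and> u k \<le> v k \<and> v k \<le> b;
          disjoint_family_on (\<lambda>k. {u k<..<v k}) {..<N}; (\<Sum>k<N. v k - u k) < \<delta>\<rbrakk>
        \<Longrightarrow> (\<Sum>k<N. norm (f (v k) - f (u k))) < e"
      using ac \<open>e > 0\<close> unfolding abs_cont_on_interval_def by meson
    have Zm: "Z \<in> lmeasurable" "measure lebesgue Z = 0"
      using Z by (auto simp: negligible_iff_measure)
    obtain W where W: "open W" "Z \<subseteq> W" "W \<in> lmeasurable" "measure lebesgue W < \<delta>"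
    proof -
      obtain W where "open W" "Z \<subseteq> W" and WZ: "W - Z \<in> lmeasurable"
        and lt: "emeasure lebesgue (W - Z) < ennreal \<delta>"
        using sets_lebesgue_outer_open[OF fmeasurableD[OF Zm(1)] \<open>\<delta> > 0\<close>] .
      have eq: "W = (W - Z) \<union> Z" using \<open>Z \<subseteq> W\<close> by blast
      have "W \<in> lmeasurable"
        by (subst eq) (intro fmeasurable.Un WZ Zm)
      moreover have "measure lebesgue W \<le> measure lebesgue (W - Z) + measure lebesgue Z"
        by (subst eq) (intro measure_Un_le fmeasurableD WZ Zm)
      moreover have "measure lebesgue (W - Z) < \<delta>"
        using lt WZ \<open>\<delta> > 0\<close> by (simp add: emeasure_eq_measure2 ennreal_less_iff)
      ultimately show ?thesis
        using that \<open>open W\<close> \<open>Z \<subseteq> W\<close> Zm(2) by simp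
    qed
    \<comment> \<open>Asking each closed interval to lie in \<open>W\<close> avoids decomposing
      \<open>W\<close> into its components.\<close>
    define P where "P t = {s. \<exists>(N::nat) u v. (\<forall>k<N. a \<le> u k \<and> u k \<le> v k \<and> v k \<le> t \<and> {u k..v k} \<subseteq> W)
      \<and> disjoint_family_on (\<lambda>k. {u k<..<v k}) {..<N} \<and> s = (\<Sum>k<N. \<bar>f (v k) - f (u k)\<bar>)}" for t
    define V where "V t = Sup (P t)" for t
    \<comment> \<open>The empty family, \<open>N = 0\<close>, keeps \<open>P t\<close> nonempty, so
      that its \<open>Sup\<close> is meaningful.\<close>
    have P0: "0 \<in> P t" for t
      unfolding P_def by (auto intro!: exI[of _ 0] simp: disjoint_family_on_def)
    have Pe: "s \<le> e" if s: "s \<in> P t" and "t \<le> b" for s t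
    proof -
      obtain N u v where *: "\<forall>k<(N::nat). a \<le> u k \<and> u k \<le> v k \<and> v k \<le> t \<and> {u k..v k} \<subseteq> W"
        "disjoint_family_on (\<lambda>k. {u k<..<v k}) {..<N}" "s = (\<Sum>k<N. \<bar>f (v k) - f (u k)\<bar>)"
        using s unfolding P_def by blast
      have "(\<Sum>k<N. v k - u k) < \<delta>"
        using sum_lengths_le_measure[OF W(3), of N u v] * W(4) by auto
      then have "(\<Sum>k<N. norm (f (v k) - f (u k))) < e"
        using * \<open>t \<le> b\<close> by (intro \<delta>) force+
      with * show ?thesis by simp
    qed
    have Pbdd: "bdd_above (P t)" if "t \<le> b" for t
      using Pe that by (meson bdd_above.I)
    have Pmono: "P s \<subseteq> P t" if "s \<le> t" for s t
      unfolding P_def using that by (blast intro: order_trans)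
    have Vmono: "V s \<le> V t" if "s \<le> t" "t \<le> b" for s t
      unfolding V_def using P0[of s] Pbdd Pmono that by (intro cSup_subset_mono) auto
    \<comment> \<open>Any family that ends by \<open>s\<close> can be lengthened by
      \<open>[s, t]\<close>, placed at index \<open>N\<close>.\<close>
    have Vext: "V s + \<bar>f t - f s\<bar> \<le> V t" if "a \<le> s" "s \<le> t" "t \<le> b" "{s..t} \<subseteq> W" for s t
    proof -
      have "p + \<bar>f t - f s\<bar> \<in> P t" if "p \<in> P s" for p
      proof -
        obtain N u v where *: "\<forall>k<(N::nat). a \<le> u k \<and> u k \<le> v k \<and> v k \<le> s \<and> {u k..v k} \<subseteq> W"
          "disjoint_family_on (\<lambda>k. {u k<..<v k}) {..<N}" "p = (\<Sum>k<N. \<bar>f (v k) - f (u k)\<bar>)"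
          using \<open>p \<in> P s\<close> unfolding P_def by blast
        let ?u = "u(N := s)" and ?v = "v(N := t)"
        have "\<forall>k<Suc N. a \<le> ?u k \<and> ?u k \<le> ?v k \<and> ?v k \<le> t \<and> {?u k..?v k} \<subseteq> W"
          using * that \<open>a \<le> s\<close> \<open>s \<le> t\<close> \<open>{s..t} \<subseteq> W\<close> by (auto simp: less_Suc_eq intro: order_trans)
        moreover have "disjoint_family_on (\<lambda>k. {?u k<..<?v k}) {..<Suc N}"
        proof -
          have "{u k<..<v k} \<inter> {s<..<t} = {}" "{s<..<t} \<inter> {u k<..<v k} = {}" if "k < N" for k
            using * that by fastforce+
          with *(2) show ?thesis
            by (auto simp: disjoint_family_on_def less_Suc_eq)
        qed
        moreover have "p + \<bar>f t - f s\<bar> = (\<Sum>k<Suc N. \<bar>f (?v k) - f (?u k)\<bar>)"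
          using * by simp
        ultimately show ?thesis unfolding P_def by blast
      qed
      then have "p + \<bar>f t - f s\<bar> \<le> V t" if "p \<in> P s" for p
        unfolding V_def using that Pbdd[OF \<open>t \<le> b\<close>] by (intro cSup_upper) auto
      then have "V s \<le> V t - \<bar>f t - f s\<bar>"
        unfolding V_def[of s] using P0 by (intro cSup_least) (auto simp: le_diff_eq)
      then show ?thesis by simp
    qed
    define S where "S = {t \<in> {a..b}. f t - f a \<le> e * (t - a) + V t}"
    define c where "c = Sup S"
    have "0 \<le> V a"
      unfolding V_def using P0 Pbdd \<open>a \<le> b\<close> by (intro cSup_upper) auto
    then have aS: "a \<in> S" using \<open>a \<le> b\<close> by (simp add: S_def)
    have bS: "bdd_above S" unfolding S_def by (rule bdd_aboveI[of _ b]) auto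
    have c_ge: "s \<le> c" if "s \<in> S" for s
      unfolding c_def using that bS by (rule cSup_upper)
    have c: "a \<le> c" "c \<le> b"
      using c_ge aS apply blast unfolding c_def using aS by (intro cSup_least) (auto simp: S_def)
    have "c \<in> S"
    proof -
      \<comment> \<open>No continuity of \<open>V\<close> is at hand. Monotonicity replaces the
        right-hand side by its value at \<open>c\<close>, and the resulting condition is closed
        because \<open>f\<close> is continuous.\<close>
      let ?M = "{t \<in> {a..b}. f t \<in> {..f a + e * (c - a) + V c}}"
      have "closed ?M"
        using continuous_closed_preimage[OF abs_cont_on_interval_imp_continuous_on[OF ac],
            of "{..f a + e * (c - a) + V c}"]
        by (simp add: vimage_def Int_def)
      moreover have "S \<subseteq> ?M"
      proof
        fix t assume t: "t \<in> S"
        have "e * (t - a) \<le> e * (c - a)" "V t \<le> V c"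
          using c_ge[OF t] \<open>e > 0\<close> c Vmono by auto
        with t show "t \<in> ?M" by (auto simp: S_def)
      qed
      ultimately have "Sup S \<in> ?M"
        using aS bS by (intro closed_subset_contains_Sup) auto
      then have "c \<in> ?M" by (simp only: c_def[symmetric])
      then show ?thesis by (auto simp: S_def)
    qed
    have "c = b"
    proof (rule ccontr)
      assume "c \<noteq> b"
      with c have "c < b" by simp
      have "\<exists>t\<in>{c<..b}. f t - f c \<le> e * (t - c) + (V t - V c)"
      proof (cases "c \<in> Z")
        case True
        then obtain r where r: "r > 0" "cball c r \<subseteq> W"
          using W open_contains_cball by blast
        define t where "t = min b (c + r)"
        have "{c..t} \<subseteq> W" using r by (auto simp: t_def cball_def dist_real_def subset_iff)
        then have "V c + \<bar>f t - f c\<bar> \<le> V t"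
          using \<open>c < b\<close> c r by (intro Vext) (auto simp: t_def)
        moreover have "c < t" "t \<le> b" using \<open>c < b\<close> r by (auto simp: t_def)
        moreover have "0 \<le> e * (t - c)" using \<open>e > 0\<close> \<open>c < t\<close> by simp
        ultimately show ?thesis by (intro bexI[of _ t]) auto
      next
        case False
        have "\<exists>\<^sub>F h in at_right 0. f (c + h) - f c \<le> e * h"
          using dini c \<open>c < b\<close> False \<open>e > 0\<close> by blast
        \<comment> \<open>The Dini bound holds for arbitrarily small \<open>h\<close>, hence for one
          with \<open>c + h < b\<close>.\<close>
        moreover have "\<forall>\<^sub>F h in at_right 0. f (c + h) - f c \<le> e * h \<longrightarrow>
            h \<in> {0<..<b - c} \<and> f (c + h) - f c \<le> e * h"
          using \<open>c < b\<close> by (intro eventually_at_rightI[of 0 "b - c"]) auto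
        ultimately have "\<exists>\<^sub>F h in at_right 0. h \<in> {0<..<b - c} \<and> f (c + h) - f c \<le> e * h"
          by (rule frequently_rev_mp)
        then obtain h where "h \<in> {0<..<b - c}" "f (c + h) - f c \<le> e * h"
          using frequently_ex by blast
        moreover from this have "V c \<le> V (c + h)" by (intro Vmono) auto
        ultimately show ?thesis by (intro bexI[of _ "c + h"]) auto
      qed
      then obtain t where t: "c < t" "t \<le> b" "f t - f c \<le> e * (t - c) + (V t - V c)"
        by auto
      then have "t \<in> S"
        using \<open>c \<in> S\<close> by (auto simp: S_def algebra_simps)
      with c_ge t show False by fastforce
    qed
    moreover have "V b \<le> e"
      unfolding V_def using P0 Pe by (intro cSup_least) auto
    ultimately show ?thesis using \<open>c \<in> S\<close> by (auto simp: S_def)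
  qed
  have "f b - f a \<le> 0"
  proof (rule field_le_epsilon)
    fix e :: real assume "e > 0"
    \<comment> \<open>Chosen so that \<open>q * (b - a) + q = e\<close>; the summand
      \<open>1\<close> keeps the denominator positive when \<open>a = b\<close>.\<close>
    define q where "q = e / (b - a + 1)"
    have "q > 0" "q * (b - a + 1) = e"
      using \<open>e > 0\<close> \<open>a \<le> b\<close> by (auto simp: q_def)
    with main[of q] show "f b - f a \<le> 0 + e" by (simp add: distrib_left)
  qed
  then show ?thesis by simp
qed

section \<open>Derivatives and tangent cones\<close>

lemma derivative_remainder_at_right:
  fixes x :: "real \<Rightarrow> 'a::real_normed_vector"
  assumes "(x has_vector_derivative v) (at t)"
  shows "((\<lambda>h. norm (x (t + h) - (x t + h *\<^sub>R v)) / h) \<longlongrightarrow> 0) (at_right 0)"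
proof -
  have "((\<lambda>h. norm (x (t + h) - x t - h *\<^sub>R v) / norm h) \<longlongrightarrow> 0) (at 0)"
    using assms unfolding has_vector_derivative_def has_derivative_at by simp
  then have "((\<lambda>h. norm (x (t + h) - x t - h *\<^sub>R v) / norm h) \<longlongrightarrow> 0) (at_right 0)"
    by (rule filterlim_mono) (auto simp: at_le)
  then show ?thesis
    by (rule Lim_transform_eventually)
      (auto simp: eventually_at_right_less diff_diff_eq intro!: eventually_at_rightI[of 0 1])
qed

text \<open>The point \<open>x (t + h)\<close> of \<open>S\<close> is within o(h) of
  \<open>x t + h *\<^sub>R v\<close>. The quotient thus has limit 0, which is more than the lower
  limit in the cone requires.\<close>

lemma derivative_in_contingent_cone:
  fixes x :: "real \<Rightarrow> 'a::euclidean_space"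
  assumes "(x has_vector_derivative v) (at t)"
    and inS: "\<forall>\<^sub>F h in at_right 0. x (t + h) \<in> S"
  shows "v \<in> contingent_cone S (x t)"
proof -
  have "((\<lambda>h. infdist (x t + h *\<^sub>R v) S / h) \<longlongrightarrow> 0) (at_right 0)"
  proof (rule tendsto_sandwich[OF _ _ tendsto_const derivative_remainder_at_right[OF assms(1)]])
    show "\<forall>\<^sub>F h in at_right 0. 0 \<le> infdist (x t + h *\<^sub>R v) S / h"
      by (intro eventually_at_rightI[of 0 1]) (auto simp: infdist_nonneg)
    have "\<forall>\<^sub>F h in at_right (0::real). h > 0"
      by (rule eventually_at_right_less)
    with inS show "\<forall>\<^sub>F h in at_right 0. infdist (x t + h *\<^sub>R v) S / h
        \<le> norm (x (t + h) - (x t + h *\<^sub>R v)) / h"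
    proof eventually_elim
      case (elim h)
      then have "infdist (x t + h *\<^sub>R v) S \<le> dist (x t + h *\<^sub>R v) (x (t + h))"
        by (intro infdist_le)
      with elim show ?case
        by (intro divide_right_mono) (auto simp: dist_norm norm_minus_commute)
    qed
  qed
  then have "((\<lambda>h. ereal (infdist (x t + h *\<^sub>R v) S / h)) \<longlongrightarrow> ereal 0) (at_right 0)"
    by (rule tendsto_ereal)
  then have "Liminf (at_right 0) (\<lambda>h. ereal (infdist (x t + h *\<^sub>R v) S / h)) = ereal 0"
    by (intro lim_imp_Liminf) auto
  then show ?thesis by (simp add: contingent_cone_def zero_ereal_def)
qed

text \<open>Replacing the tangent line by the arc changes the distance to \<open>K\<close> by o(h)
  only. Half of \<open>e\<close> covers this error, the other half the lower limit along the
  line.\<close>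

lemma infdist_Dini_le_external_contingent_cone:
  fixes x :: "real \<Rightarrow> 'a::euclidean_space"
  assumes der: "(x has_vector_derivative v) (at t)"
    and v: "v \<in> external_contingent_cone K (x t)" and "e > 0"
  shows "\<exists>\<^sub>F h in at_right 0. infdist (x (t + h)) K - infdist (x t) K \<le> e * h"
proof -
  let ?q = "\<lambda>h. (infdist (x t + h *\<^sub>R v) K - infdist (x t) K) / h"
  have "\<exists>\<^sub>F h in at_right 0. ?q h < e / 2"
  proof (rule ccontr)
    \<comment> \<open>Otherwise the quotient would eventually be at least \<open>e / 2\<close>, and
      so would its lower limit.\<close>
    assume "\<not> ?thesis"
    then have "\<forall>\<^sub>F h in at_right 0. ereal (e / 2) \<le> ereal (?q h)"
      by (simp add: frequently_def not_less)
    then have "ereal (e / 2) \<le> Liminf (at_right 0) (\<lambda>h. ereal (?q h))"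
      by (rule Liminf_bounded)
    also have "\<dots> \<le> 0" using v by (simp add: external_contingent_cone_def)
    finally show False using \<open>e > 0\<close> by (simp add: zero_ereal_def)
  qed
  moreover have "\<forall>\<^sub>F h in at_right 0. norm (x (t + h) - (x t + h *\<^sub>R v)) / h < e / 2"
    using order_tendstoD(2)[OF derivative_remainder_at_right[OF der], of "e / 2"] \<open>e > 0\<close> by simp
  then have "\<forall>\<^sub>F h in at_right 0. ?q h < e / 2 \<longrightarrow>
      infdist (x (t + h)) K - infdist (x t) K \<le> e * h"
    using eventually_at_right_less[of 0]
  proof eventually_elim
    case (elim h)
    show ?case
    proof
      assume "?q h < e / 2"
      with elim have "infdist (x t + h *\<^sub>R v) K - infdist (x t) K < e / 2 * h"
        "norm (x (t + h) - (x t + h *\<^sub>R v)) < e / 2 * h"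
        by (auto simp: pos_divide_less_eq)
      with infdist_diff_le_norm[of "x (t + h)" K "x t + h *\<^sub>R v"]
      show "infdist (x (t + h)) K - infdist (x t) K \<le> e * h"
        by (simp add: abs_le_iff)
    qed
  qed
  ultimately show ?thesis by (rule frequently_rev_mp)
qed

section \<open>Invariance along flows\<close>

text \<open>The cone condition is available only in \<open>U - K\<close>, so the distance to
  \<open>K\<close> is followed from the last time \<open>c\<close> at which the arc is in
  \<open>K\<close>, and only while the arc remains in \<open>U\<close>.\<close>

lemma flow_stays_in_closed_set:
  fixes x :: "real \<Rightarrow> 'a::euclidean_space"
  assumes ac: "abs_cont_on_interval a b x" and "a \<le> b" and xa: "x a \<in> K"
    and K: "closed K" and U: "open U" "frontier K \<subseteq> U"
    and xC: "\<And>t. \<lbrakk>a < t; t < b\<rbrakk> \<Longrightarrow> x t \<in> C"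
    and Z: "negligible Z"
    and der: "\<And>t. \<lbrakk>a < t; t < b; t \<notin> Z\<rbrakk> \<Longrightarrow> \<exists>v\<in>F (x t). (x has_vector_derivative v) (at t)"
    and cone: "\<And>y v. \<lbrakk>y \<in> U - K; y \<in> C; v \<in> F y; v \<in> contingent_cone C y\<rbrakk>
      \<Longrightarrow> v \<in> external_contingent_cone K y"
  shows "x b \<in> K"
proof (rule ccontr)
  assume xb: "x b \<notin> K"
  have cont: "continuous_on {a..b} x"
    by (rule abs_cont_on_interval_imp_continuous_on[OF ac])
  define S where "S = {t \<in> {a..b}. x t \<in> K}"
  define c where "c = Sup S"
  have "closed S"
    using continuous_closed_preimage[OF cont _ K] by (simp add: S_def vimage_def Int_def)
  moreover have S: "S \<noteq> {}" "bdd_above S"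
    using xa \<open>a \<le> b\<close> by (auto simp: S_def intro!: bdd_aboveI[of _ b])
  ultimately have "c \<in> S"
    unfolding c_def by (intro closed_contains_Sup)
  then have c: "a \<le> c" "c < b" "x c \<in> K"
    using xb by (auto simp: S_def order.strict_iff_order)
  have notK: "x t \<notin> K" if "c < t" "t \<le> b" for t
  proof
    assume "x t \<in> K"
    then have "t \<in> S" using that c by (simp add: S_def)
    then show False using cSup_upper[of t S] S that by (auto simp: c_def)
  qed
  have lim: "(x \<longlongrightarrow> x c) (at_right c)"
    using continuous_on_Icc_at_rightD[OF continuous_on_subset[OF cont]] c by auto
  \<comment> \<open>The arc is outside \<open>K\<close> right after \<open>c\<close>, so
    \<open>x c\<close> is a limit of points of the complement.\<close>
  have "x c \<in> frontier K"
  proof -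
    have "x c \<in> closure (- K)"
    proof (rule Lim_in_closed_set[OF closed_closure _ _ lim])
      show "\<forall>\<^sub>F t in at_right c. x t \<in> closure (- K)"
        using notK c closure_subset by (intro eventually_at_rightI[of c b]) fastforce+
    qed simp
    then show ?thesis
      using c closure_subset by (auto simp: frontier_closures)
  qed
  then have "\<forall>\<^sub>F t in at_right c. x t \<in> U"
    using topological_tendstoD[OF lim U(1)] U(2) by blast
  then obtain r where "r > c" and r: "\<And>t. \<lbrakk>c < t; t < r\<rbrakk> \<Longrightarrow> x t \<in> U"
    by (auto simp: eventually_at_right_field)
  \<comment> \<open>If \<open>e = r\<close>, then \<open>x e\<close> itself may lie outside
    \<open>U\<close>; the Dini condition is only checked at times before \<open>e\<close>.\<close>
  define e where "e = min b r"
  have e: "c < e" "e \<le> b" "e \<le> r" using c \<open>r > c\<close> by (auto simp: e_def)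
  let ?d = "\<lambda>t. infdist (x t) K"
  have "?d e \<le> ?d c"
  \<comment> \<open>At time \<open>c\<close> the arc is still in \<open>K\<close>, where
    \<open>cone\<close> says nothing, so \<open>c\<close> joins the null set.\<close>
  proof (rule abs_cont_Dini_nonincreasing[where f = ?d and Z = "insert c Z"])
    show "c \<le> e" using e by simp
    have "abs_cont_on_interval a b ?d"
      by (rule abs_cont_on_interval_mono[OF ac]) (simp add: infdist_diff_le_norm)
    then show "abs_cont_on_interval c e ?d"
      by (rule abs_cont_on_interval_subinterval) (use c e in auto)
    show "negligible (insert c Z)" using Z by simp
    fix t \<epsilon> :: real assume t: "c \<le> t" "t < e" "t \<notin> insert c Z" and "\<epsilon> > 0"
    have t': "a < t" "c < t" "t < b" using t c e by auto
    obtain v where v: "v \<in> F (x t)" "(x has_vector_derivative v) (at t)"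
      using der t t' by auto
    have "\<forall>\<^sub>F h in at_right 0. x (t + h) \<in> C"
      using t' by (intro eventually_at_rightI[of 0 "b - t"] xC) auto
    then have "v \<in> contingent_cone C (x t)"
      using v by (intro derivative_in_contingent_cone)
    then have "v \<in> external_contingent_cone K (x t)"
      using v t t' e r notK xC by (intro cone) auto
    then show "\<exists>\<^sub>F h in at_right 0. ?d (t + h) - ?d t \<le> \<epsilon> * h"
      using v \<open>\<epsilon> > 0\<close> by (intro infdist_Dini_le_external_contingent_cone)
  qed
  also have "?d c = 0" using c by simp
  \<comment> \<open>Distance \<open>0\<close> means membership only for a nonempty closed set;
    \<open>x c\<close> shows that \<open>K\<close> is nonempty.\<close>
  finally have "x e \<in> K"
    using c K by (subst in_closed_iff_infdist_zero) (auto intro: antisym infdist_nonneg)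
  with notK e show False by blast
qed

section \<open>Invariance along hybrid solutions\<close>

text \<open>If \<open>a < b\<close>, the open interval lies in the interior of the time slice. There
  the flow conditions apply and derivatives within the slice are ordinary two-sided ones.\<close>

lemma hybrid_solution_flow_stays:
  fixes H :: "'a::euclidean_space hybrid_system"
  assumes sol: "hybrid_solution H E x"
    and K: "closed K" and U: "open U" "frontier K \<subseteq> U"
    and cone: "\<And>y v. \<lbrakk>y \<in> U - K; y \<in> flow_set H; v \<in> flow_map H y;
        v \<in> contingent_cone (flow_set H) y\<rbrakk> \<Longrightarrow> v \<in> external_contingent_cone K y"
    and ab: "{a..b} \<subseteq> time_slice E j" "a \<le> b" and xa: "x a j \<in> K"
  shows "x b j \<in> K"
proof (cases "a < b")
  case True
  let ?I = "time_slice E j"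
  have int: "{a<..<b} \<subseteq> interior ?I"
    using ab by (intro interior_maximal) (auto simp: subset_iff)
  with True have ne: "interior ?I \<noteq> {}" by auto
  have xC: "\<forall>t\<in>interior ?I. x t j \<in> flow_set H"
    and ae: "AE t in lebesgue. t \<in> ?I \<longrightarrow>
        (\<exists>v \<in> flow_map H (x t j). ((\<lambda>s. x s j) has_vector_derivative v) (at t within ?I))"
    using sol ne unfolding hybrid_solution_def by blast+
  obtain Z where Z: "negligible Z"
    and der: "\<And>t. \<lbrakk>t \<notin> Z; t \<in> ?I\<rbrakk> \<Longrightarrow>
        \<exists>v \<in> flow_map H (x t j). ((\<lambda>s. x s j) has_vector_derivative v) (at t within ?I)"
    using ae unfolding eventually_ae_filter negligible_iff_null_sets by (simp add: subset_eq) blast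
  show ?thesis
  proof (rule flow_stays_in_closed_set[where x = "\<lambda>t. x t j" and C = "flow_set H" and F = "flow_map H"])
    show "abs_cont_on_interval a b (\<lambda>t. x t j)"
      using sol ab unfolding hybrid_solution_def locally_abs_cont_on_def by blast
    show "\<exists>v\<in>flow_map H (x t j). ((\<lambda>t. x t j) has_vector_derivative v) (at t)"
      if "a < t" "t < b" "t \<notin> Z" for t
    proof -
      have t: "t \<in> interior ?I" using int that by auto
      show ?thesis
        using der[OF that(3) subsetD[OF interior_subset t]] by (simp only: at_within_interior[OF t])
    qed
    show "x t j \<in> flow_set H" if "a < t" "t < b" for t
      using int xC that by auto
  qed (use K U cone xa Z ab in auto)
qed (use ab xa in auto)

text \<open>Up to \<open>(T, J)\<close> the domain is a finite alternation of flow intervals and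
  jumps, so membership in \<open>K\<close> propagates by induction on the number of jumps.\<close>

lemma hybrid_solution_stays:
  assumes sol: "hybrid_solution H E x" and x0: "x 0 0 \<in> K"
    and flow: "\<And>a b j. \<lbrakk>{a..b} \<subseteq> time_slice E j; a \<le> b; x a j \<in> K\<rbrakk> \<Longrightarrow> x b j \<in> K"
    and jump: "\<And>y \<eta>. \<lbrakk>y \<in> jump_set H; y \<in> K; \<eta> \<in> jump_map H y\<rbrakk> \<Longrightarrow> \<eta> \<in> K"
    and TJ: "(T, J) \<in> E"
  shows "x T J \<in> K"
proof -
  have dom: "hybrid_time_domain E" using sol by (simp add: hybrid_solution_def)
  then have E0: "E \<subseteq> {0..} \<times> UNIV" by (simp add: hybrid_time_domain_def)
  obtain t :: "nat \<Rightarrow> real" where t0: "t 0 = 0"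
    and tE: "E \<inter> ({0..T} \<times> {..J}) = (\<Union>j\<le>J. {t j..t (Suc j)} \<times> {j})"
    and mono: "\<forall>j\<le>J. t j \<le> t (Suc j)"
    using dom bspec[OF conjunct2[OF dom[unfolded hybrid_time_domain_def]] TJ] by auto
  have slice: "{t j..t (Suc j)} \<subseteq> time_slice E j" if "j \<le> J" for j
    using tE that by (auto simp: time_slice_def)
  have flow': "x s j \<in> K" if "j \<le> J" "x (t j) j \<in> K" "s \<in> {t j..t (Suc j)}" for j s
    using slice[OF that(1)] that by (intro flow[of "t j" s j]) auto
  have start: "x (t j) j \<in> K" if "j \<le> J" for j
    using that
  proof (induction j)
    case 0
    then show ?case by (simp add: t0 x0)
  next
    case (Suc j)
    have "x (t (Suc j)) j \<in> K"
      using Suc mono by (auto intro!: flow'[of j "t (Suc j)"])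
    \<comment> \<open>The jump time is both the right end of interval \<open>j\<close> and the left
      end of interval \<open>Suc j\<close>; \<open>mono\<close> makes both intervals
      nonempty.\<close>
    moreover have "(t (Suc j), j) \<in> E" "(t (Suc j), Suc j) \<in> E"
      using slice[of j] slice[of "Suc j"] spec[OF mono, of j] spec[OF mono, of "Suc j"] Suc.prems
      by (auto simp: time_slice_def subset_iff)
    ultimately show ?case
      using sol jump unfolding hybrid_solution_def by blast
  qed
  have "(T, J) \<in> E \<inter> ({0..T} \<times> {..J})" using TJ E0 by auto
  then have "T \<in> {t J..t (Suc J)}" unfolding tE by auto
  with start flow' show ?thesis by blast
qed

theorem theorem3:
  fixes H :: "(real^'n) hybrid_system"
    and B :: "real^'n \<Rightarrow> real^'m"
    and K U :: "(real^'n) set"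
  assumes "outer_semicontinuous (flow_map H)"
    and "locally_bounded_map (flow_map H)"
    and "\<forall>x. flow_map H x \<noteq> {} \<and> convex (flow_map H x)"
    and "\<forall>x \<in> jump_set H. jump_map H x \<noteq> {}"
    and "barrier_candidate H B K"
    and "closed K"
    and "\<forall>x \<in> jump_set H \<inter> K. \<forall>\<eta> \<in> jump_map H x. B \<eta> \<le> 0"
    and "\<forall>x \<in> jump_set H \<inter> K. jump_map H x \<subseteq> flow_set H \<union> jump_set H"
    and "open U" and "frontier K \<subseteq> U"
    and "\<forall>x \<in> (U - K) \<inter> flow_set H.
           \<forall>\<eta> \<in> flow_map H x \<inter> contingent_cone (flow_set H) x.
             \<eta> \<in> external_contingent_cone K x"
  shows "forward_pre_invariant H K"
proof -
  note B = assms(5) and KU = assms(6,9,10) and G = assms(7,8) and cone = assms(11)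
  have K: "K = {x \<in> flow_set H \<union> jump_set H. B x \<le> 0}"
    using B by (simp add: barrier_candidate_def)
  have "x t j \<in> K"
    if "maximal_hybrid_solution H E x" "x 0 0 \<in> K" "(t, j) \<in> E" for E x t j
  proof -
    have sol: "hybrid_solution H E x"
      using that(1) by (simp add: maximal_hybrid_solution_def)
    show ?thesis
    proof (rule hybrid_solution_stays[OF sol that(2) _ _ that(3)])
      show "x b i \<in> K" if "{a..b} \<subseteq> time_slice E i" "a \<le> b" "x a i \<in> K" for a b i
        using hybrid_solution_flow_stays[OF sol KU _ that] cone by blast
      \<comment> \<open>The two jump hypotheses supply the two halves of the description of
        \<open>K\<close> by \<open>B\<close>.\<close>
      show "\<eta> \<in> K" if "y \<in> jump_set H" "y \<in> K" "\<eta> \<in> jump_map H y" for y \<eta>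
      proof -
        have "B \<eta> \<le> 0" "\<eta> \<in> flow_set H \<union> jump_set H" using G that by blast+
        then show ?thesis unfolding K by simp
      qed
    qed
  qed
  moreover have "K \<subseteq> flow_set H \<union> jump_set H" unfolding K by blast
  ultimately show ?thesis
    unfolding forward_pre_invariant_def by blast
qed

end
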